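(* Let $\mathcal{H}$ be a finite-dimensional complex Hilbert space with fixed orthonormal basis $\{|i\rangle\}$, and let $\hat G$ be a negative SWAP-invariant Hamiltonian on $\mathcal{H}_A\otimes\mathcal{H}_B=\mathcal{H}^{\otimes 2}$ with a non-degenerate (normalized) ground state $|\psi\rangle$. Then the logarithmic negativity of the ground state with respect to the bipartition $A|B$ (left half versus right half) is given by $$E_{\text{l.n.}}(|\psi\rangle\langle\psi|)=\log\operatorname{tr}\bigl[|\tilde\Phi\rangle\langle\tilde\Phi|\,|\psi\rangle\langle\psi|\bigr],\qquad |\tilde\Phi\rangle=\sum_i|i\rangle|i\rangle .$$
   Context: A Hamiltonian is a Hermitian operator. A Hamiltonian $\hat G$ on $\mathcal{H}\otimes\mathcal{H}$ is called negative SWAP-invariant if it can be written as $$\hat G=\mathbb{1}\otimes\hat A+\hat A\otimes\mathbb{1}+\sum_k b_k\,\hat B_k\otimes\hat B_k$$ (finite sum) with real numbers $b_k\le 0$ for all $k$ and operators $\hat A,\hat B_k$ on $\mathcal{H}$ that are real (i.e. have real matrix entries in the fixed basis $\{|i\rangle\}$) but not necessarily Hermitian. Such a $\hat G$ is in particular invariant under exchange of the two tensor factors. In the case of a chain of $N$ spins ($N$ even), $\mathcal{H}$ is the space of $N/2$ spins, the fixed basis is the product basis $|i\rangle=|i_1\cdots i_{N/2}\rangle$, and $|\tilde\Phi\rangle=\sum_{i_1,\dots,i_{N/2}}|i_1\cdots i_{N/2}\rangle|i_1\cdots i_{N/2}\rangle$. A non-degenerate ground state is a unit eigenvector for the smallest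 eigenvalue, when that eigenvalue is simple. The logarithmic negativity of a density matrix $\hat\varrho$ is $E_{\text{l.n.}}(\hat\varrho)=\log\|\hat\varrho^\Gamma\|_1$, where $\hat\varrho^\Gamma$ is the partial transpose (in the fixed basis) with respect to the bipartition $A|B$, $\|\hat X\|_1=\operatorname{tr}|\hat X|$ is the trace norm, and the same base of the logarithm is used on both sides. *)

theory Defs
  imports "HOL-Analysis.Analysis"
begin

(* The Hilbert space with its fixed orthonormal basis is complex ^ 'n with the basis vectors
   axis i 1, its tensor square is complex ^ ('n \<times> 'n) with the product basis, and operators are
   identified with their matrices in these bases. *)

definition cinner :: "complex ^ 'n \<Rightarrow> complex ^ 'n \<Rightarrow> complex" where
  "cinner v w = (\<Sum>i\<in>UNIV. cnj (v $ i) * w $ i)"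

definition cadjoint :: "complex ^ 'n ^ 'm \<Rightarrow> complex ^ 'm ^ 'n" where
  "cadjoint A = (\<chi> i j. cnj (A $ j $ i))"

definition hermitian :: "complex ^ 'n ^ 'n \<Rightarrow> bool" where
  "hermitian A \<longleftrightarrow> cadjoint A = A"

definition real_matrix :: "complex ^ 'n ^ 'm \<Rightarrow> bool" where
  "real_matrix A \<longleftrightarrow> (\<forall>i j. A $ i $ j \<in> \<real>)"

definition psd :: "complex ^ 'n ^ 'n \<Rightarrow> bool" where
  "psd A \<longleftrightarrow> hermitian A \<and> (\<forall>v. 0 \<le> Re (cinner v (A *v v)))"

definition ketbra :: "complex ^ 'm \<Rightarrow> complex ^ 'n \<Rightarrow> complex ^ 'n ^ 'm" where
  "ketbra v w = (\<chi> i j. v $ i * cnj (w $ j))"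

definition tensor_vec :: "complex ^ 'm \<Rightarrow> complex ^ 'n \<Rightarrow> complex ^ ('m \<times> 'n)" where
  "tensor_vec v w = (\<chi> p. v $ fst p * w $ snd p)"

definition tensor_op ::
  "complex ^ 'm ^ 'm \<Rightarrow> complex ^ 'n ^ 'n \<Rightarrow> complex ^ ('m \<times> 'n) ^ ('m \<times> 'n)" where
  "tensor_op A B = (\<chi> p q. A $ fst p $ fst q * B $ snd p $ snd q)"

definition negative_swap_invariant :: "complex ^ ('n::finite \<times> 'n) ^ ('n \<times> 'n) \<Rightarrow> bool" where
  "negative_swap_invariant G \<longleftrightarrow>
     hermitian G \<and>
     (\<exists>(A :: complex ^ 'n ^ 'n) (m :: nat) (b :: nat \<Rightarrow> real) (B :: nat \<Rightarrow> complex ^ 'n ^ 'n).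
        real_matrix A \<and> (\<forall>k<m. b k \<le> 0 \<and> real_matrix (B k)) \<and>
        G = tensor_op (mat 1) A + tensor_op A (mat 1)
            + (\<Sum>k<m. b k *\<^sub>R tensor_op (B k) (B k)))"

definition eigenspace :: "complex ^ 'n ^ 'n \<Rightarrow> complex \<Rightarrow> (complex ^ 'n) set" where
  "eigenspace G \<mu> = {v. G *v v = \<mu> *s v}"

definition eigenvalue :: "complex ^ 'n ^ 'n \<Rightarrow> complex \<Rightarrow> bool" where
  "eigenvalue G \<mu> \<longleftrightarrow> (\<exists>v. v \<noteq> 0 \<and> v \<in> eigenspace G \<mu>)"

(* Intended for Hermitian G: all eigenvalues are then real, and an eigenvalue is simple iff its
   eigenspace has complex dimension 1 (vec.dim is the dimension over the complex field). *)
definition nondegenerate_ground_state ::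
  "complex ^ 'n::finite ^ 'n \<Rightarrow> complex ^ 'n \<Rightarrow> bool" where
  "nondegenerate_ground_state G \<psi> \<longleftrightarrow>
     norm \<psi> = 1 \<and>
     (\<exists>E :: real.
        \<psi> \<in> eigenspace G (complex_of_real E) \<and>
        (\<forall>\<mu> :: real. eigenvalue G (complex_of_real \<mu>) \<longrightarrow> E \<le> \<mu>) \<and>
        vec.dim (eigenspace G (complex_of_real E)) = 1)"

(* The operator absolute value: the unique positive semidefinite square root of X\<^sup>* X. *)
definition op_abs :: "complex ^ 'n ^ 'n \<Rightarrow> complex ^ 'n ^ 'n" where
  "op_abs X = (THE P. psd P \<and> P ** P = cadjoint X ** X)"

(* The trace of a positive semidefinite matrix is real, so Re only changes the type. *)
definition trace_norm :: "complex ^ 'n ^ 'n \<Rightarrow> real" where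
  "trace_norm X = Re (trace (op_abs X))"

(* Transposes the first tensor factor. Transposing the second one instead gives the transposed
   matrix, which has the same trace norm. *)
definition partial_transpose ::
  "complex ^ ('m::finite \<times> 'n::finite) ^ ('m \<times> 'n) \<Rightarrow> complex ^ ('m \<times> 'n) ^ ('m \<times> 'n)" where
  "partial_transpose \<rho> = (\<chi> p q. \<rho> $ (fst q, snd p) $ (fst p, snd q))"

definition log_negativity :: "real \<Rightarrow> complex ^ ('m::finite \<times> 'n::finite) ^ ('m \<times> 'n) \<Rightarrow> real" where
  "log_negativity b \<rho> = log b (trace_norm (partial_transpose \<rho>))"

definition Phi :: "complex ^ ('n::finite \<times> 'n)" where
  "Phi = (\<Sum>i\<in>UNIV. tensor_vec (axis i 1) (axis i 1))"

end

theory Submission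
  imports Defs
begin

text \<open>
  Read a vector of the tensor square as a matrix \<open>M\<close>. Then \<open>G\<close> acts by
  \<open>M \<mapsto> A M + M A\<^sup>T + \<Sum>k. b\<^sub>k B\<^sub>k M B\<^sub>k\<^sup>T\<close>, and since the coefficients are real
  it commutes with \<open>M \<mapsto> M\<^sup>*\<close>. Hence the ground space contains a nonzero Hermitian matrix
  \<open>H = \<Sum>u. l\<^sub>u u u\<^sup>*\<close>. Its energy is a form in the \<open>l\<^sub>u\<close> whose off-diagonal coefficients
  \<open>\<Sum>k. b\<^sub>k |\<langle>u, B\<^sub>k w\<rangle>|\<^sup>2\<close> are nonpositive, so passing from \<open>H\<close> to \<open>|H|\<close> does not increase the
  energy (reflection positivity). By non-degeneracy the ground state is \<open>z |H|\<close>. The partial transpose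
  of its projector then has an explicit singular value decomposition, with singular values
  \<open>|z|\<^sup>2 |l\<^sub>u| |l\<^sub>w|\<close>, whose sum \<open>(|z| tr |H|)\<^sup>2\<close> is the squared modulus of the overlap with \<open>\<Sum>i. |i\<rangle>|i\<rangle>\<close>.
\<close>

section \<open>The spectral theorem for Hermitian matrices\<close>

lemma cinner_add_left: "cinner (x + y) z = cinner x z + cinner y z"
  by (simp add: cinner_def algebra_simps sum.distrib)

lemma cinner_add_right: "cinner x (y + z) = cinner x y + cinner x z"
  by (simp add: cinner_def algebra_simps sum.distrib)

lemma cinner_diff_left: "cinner (x - y) z = cinner x z - cinner y z"
  by (simp add: cinner_def algebra_simps sum_subtractf)

lemma cinner_diff_right: "cinner x (y - z) = cinner x y - cinner x z"
  by (simp add: cinner_def algebra_simps sum_subtractf)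

lemma cinner_zero_left [simp]: "cinner 0 x = 0"
  by (simp add: cinner_def)

lemma cinner_zero_right [simp]: "cinner x 0 = 0"
  by (simp add: cinner_def)

lemma cinner_smult_left: "cinner (c *s x) y = cnj c * cinner x y"
  by (simp add: cinner_def sum_distrib_left algebra_simps)

lemma cinner_smult_right: "cinner x (c *s y) = c * cinner x y"
  by (simp add: cinner_def sum_distrib_left algebra_simps)

lemma cinner_sum_left: "cinner (\<Sum>i\<in>I. f i) y = (\<Sum>i\<in>I. cinner (f i) y)"
  by (induction I rule: infinite_finite_induct) (simp_all add: cinner_add_left)

lemma cinner_sum_right: "cinner x (\<Sum>i\<in>I. f i) = (\<Sum>i\<in>I. cinner x (f i))"
  by (induction I rule: infinite_finite_induct) (simp_all add: cinner_add_right)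

lemma cnj_cinner: "cnj (cinner x y) = cinner y x"
  by (simp add: cinner_def mult.commute)

lemma Re_cinner: "Re (cinner x y) = inner x y"
  by (simp add: cinner_def inner_vec_def inner_complex_def)

lemma cinner_self: "cinner x x = complex_of_real ((norm x)\<^sup>2)"
proof (rule complex_eqI)
  show "Re (cinner x x) = Re (complex_of_real ((norm x)\<^sup>2))"
    by (simp add: Re_cinner power2_norm_eq_inner)
  show "Im (cinner x x) = Im (complex_of_real ((norm x)\<^sup>2))"
    by (simp add: cinner_def)
qed

lemma cinner_self_eq_0 [simp]: "cinner x x = 0 \<longleftrightarrow> x = 0"
  by (simp add: cinner_self)

lemma cinner_mult_vec_left: "cinner (A *v x) y = cinner x (cadjoint A *v y)"
proof -
  have "cinner (A *v x) y = (\<Sum>i\<in>UNIV. \<Sum>j\<in>UNIV. cnj (A $ i $ j) * cnj (x $ j) * y $ i)"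
    by (simp add: cinner_def matrix_vector_mult_def sum_distrib_right)
  also have "\<dots> = (\<Sum>j\<in>UNIV. \<Sum>i\<in>UNIV. cnj (A $ i $ j) * cnj (x $ j) * y $ i)"
    by (rule sum.swap)
  also have "\<dots> = cinner x (cadjoint A *v y)"
    by (simp add: cinner_def matrix_vector_mult_def cadjoint_def sum_distrib_left mult_ac)
  finally show ?thesis .
qed

lemma hermitian_cinner: "hermitian A \<Longrightarrow> cinner (A *v x) y = cinner x (A *v y)"
  by (simp add: cinner_mult_vec_left hermitian_def)

lemma mult_vec_smult: "A *v (c *s x) = c *s (A *v (x :: complex ^ 'n))"
  by (simp add: vec_eq_iff matrix_vector_mult_def sum_distrib_left mult_ac)

lemma mult_vec_sum: "A *v (\<Sum>i\<in>I. f i) = (\<Sum>i\<in>I. A *v (f i :: complex ^ 'n))"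
  by (induction I rule: infinite_finite_induct) (simp_all add: matrix_vector_right_distrib)

lemma sum_mult_vec: "(\<Sum>i\<in>I. A i) *v x = (\<Sum>i\<in>I. A i *v (x :: complex ^ 'n))"
  by (induction I rule: infinite_finite_induct) (simp_all add: matrix_vector_mult_add_rdistrib)

section \<open>Orthonormal families and eigenvectors\<close>

definition orthonormal :: "('i \<Rightarrow> complex ^ 'n) \<Rightarrow> 'i set \<Rightarrow> bool" where
  "orthonormal e I \<longleftrightarrow> (\<forall>i\<in>I. \<forall>j\<in>I. cinner (e i) (e j) = (if i = j then 1 else 0))"

lemma orthonormalD:
  "orthonormal e I \<Longrightarrow> i \<in> I \<Longrightarrow> j \<in> I \<Longrightarrow> cinner (e i) (e j) = (if i = j then 1 else 0)"
  by (simp add: orthonormal_def)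

lemma cinner_orthonormal_sum:
  assumes "finite I" "orthonormal e I" "j \<in> I"
  shows "cinner (e j) (\<Sum>i\<in>I. c i *s e i) = c j"
  using assms by (simp add: cinner_sum_right cinner_smult_right orthonormalD if_distrib cong: if_cong)

text \<open>The real part of \<open>cinner\<close> is the real inner product, so complex
  orthonormality implies real linear independence. The bound is the real dimension, twice the
  complex one; it serves only to make a largest orthonormal set exist.\<close>

lemma orthonormal_id_finite:
  fixes S :: "(complex ^ 'n::finite) set"
  assumes "orthonormal id S"
  shows "finite S \<and> card S \<le> DIM(complex ^ 'n)"
proof (rule independent_bound, rule pairwise_orthogonal_independent)
  show "pairwise orthogonal S"
    using assms by (auto simp: pairwise_def orthogonal_def orthonormal_def simp flip: Re_cinner)
  show "0 \<notin> S"
    using assms by (force simp: orthonormal_def)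
qed

text \<open>First-order optimality: for small \<open>t\<close> a positive linear term outgrows any
  quadratic one.\<close>

lemma quadratic_nonneg_imp_zero:
  fixes a C :: real
  assumes "\<And>t. t > 0 \<Longrightarrow> 2 * t * a \<le> t\<^sup>2 * C" "a \<ge> 0"
  shows "a = 0"
proof (rule ccontr)
  assume "a \<noteq> 0"
  with assms have a: "a > 0" by simp
  define t where "t = a / (\<bar>C\<bar> + 1)"
  have t: "t > 0" using a by (simp add: t_def)
  have "2 * t * a \<le> t * (t * C)" using assms(1)[OF t] by (simp add: power2_eq_square mult_ac)
  then have "2 * a \<le> t * C" using t by simp
  also have "t * C \<le> t * (\<bar>C\<bar> + 1)" using t by (intro mult_left_mono) auto
  also have "\<dots> = a" unfolding t_def by simp
  finally show False using a by simp
qed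

text \<open>The eigenvector is a minimizer of the Rayleigh quotient on the unit sphere of the subspace.\<close>

lemma hermitian_eigenvector_in_subspace:
  fixes H :: "complex ^ 'n::finite ^ 'n"
  assumes H: "hermitian H" and W: "closed W" "vec.subspace W" "\<And>x. x \<in> W \<Longrightarrow> H *v x \<in> W"
    and ne: "w \<in> W" "w \<noteq> 0"
  shows "\<exists>v\<in>W. \<exists>l. norm v = 1 \<and> H *v v = complex_of_real l *s v"
proof -
  let ?q = "\<lambda>v. Re (cinner v (H *v v))"
  have scale: "?q (complex_of_real r *s x) = r\<^sup>2 * ?q x" for r x
    by (simp add: mult_vec_smult cinner_smult_left cinner_smult_right power2_eq_square)
  have nscale: "norm (complex_of_real r *s x) = \<bar>r\<bar> * norm x" for r and x :: "complex ^ 'n"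
  proof -
    have "complex_of_real r *s x = r *\<^sub>R x" by (simp add: vec_eq_iff scaleR_conv_of_real [where 'a = complex])
    then show ?thesis by simp
  qed
  have "compact (sphere 0 1 \<inter> W)"
    by (simp add: W(1) compact_Int_closed)
  moreover have "complex_of_real (1 / norm w) *s w \<in> sphere 0 1 \<inter> W"
    using ne W(2) nscale[of "1 / norm w" w] by (auto intro: vec.subspace_scale)
  then have "sphere 0 1 \<inter> W \<noteq> {}" by blast
  moreover have "continuous_on (sphere 0 1 \<inter> W) ?q"
    unfolding cinner_def matrix_vector_mult_def by (intro continuous_intros)
  ultimately obtain v where v: "v \<in> sphere 0 1 \<inter> W" and
    min: "\<And>x. x \<in> sphere 0 1 \<inter> W \<Longrightarrow> ?q v \<le> ?q x"
    using continuous_attains_inf[of "sphere 0 1 \<inter> W" ?q] by blast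
  define l where "l = ?q v"
  have vW: "v \<in> W" and nv: "norm v = 1" using v by auto
  \<comment> \<open>Homogeneity of degree two extends the bound from the unit sphere to all of
    \<open>W\<close>.\<close>
  have ge: "l * (norm x)\<^sup>2 \<le> ?q x" if "x \<in> W" for x
  proof (cases "x = 0")
    case False
    have "complex_of_real (1 / norm x) *s x \<in> sphere 0 1 \<inter> W"
      using False that W(2) nscale[of "1 / norm x" x] by (auto intro: vec.subspace_scale)
    then have "l \<le> ?q (complex_of_real (1 / norm x) *s x)"
      unfolding l_def by (rule min)
    also have "\<dots> = ?q x / (norm x)\<^sup>2" by (subst scale) (simp add: field_simps)
    finally show ?thesis using False by (simp add: field_simps)
  qed simp
  \<comment> \<open>\<open>d\<close> is the residual of the eigenvalue equation. Moving from
    \<open>v\<close> to \<open>v - t d\<close> changes \<open>?q x - l |x|^2\<close> from 0 by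
    \<open>-2 t |d|^2\<close> to first order; minimality forbids a decrease, hence
    \<open>d = 0\<close>.\<close>
  define d where "d = H *v v - complex_of_real l *s v"
  have dW: "d \<in> W" unfolding d_def using W vW
    by (intro vec.subspace_diff vec.subspace_scale) auto
  have "(norm d)\<^sup>2 = 0"
  proof (rule quadratic_nonneg_imp_zero)
    fix t :: real assume "t > 0"
    let ?x = "v - complex_of_real t *s d"
    have "?x \<in> W" using W vW dW by (intro vec.subspace_diff vec.subspace_scale) auto
    then have "l * (norm ?x)\<^sup>2 \<le> ?q ?x" by (rule ge)
    moreover have "(norm ?x)\<^sup>2 = Re (cinner ?x ?x)" by (simp add: cinner_self)
    moreover have "Re (cinner ?x ?x) = 1 - 2 * t * Re (cinner d v) + t\<^sup>2 * (norm d)\<^sup>2"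
    proof -
      have "Re (cinner v d) = Re (cinner d v)"
        by (simp add: Re_cinner inner_commute)
      then show ?thesis
        by (simp add: cinner_diff_left cinner_diff_right cinner_smult_left cinner_smult_right
            cinner_self[of v] cinner_self[of d] nv power2_eq_square algebra_simps)
    qed
    moreover have "?q ?x = l - 2 * t * Re (cinner d (H *v v)) + t\<^sup>2 * ?q d"
    proof -
      have "Re (cinner v (H *v d)) = Re (cinner d (H *v v))"
        using hermitian_cinner[OF H, of v d] by (metis Re_cinner inner_commute)
      then show ?thesis
        by (simp add: l_def matrix_vector_mult_diff_distrib mult_vec_smult cinner_diff_left
          cinner_diff_right cinner_smult_left cinner_smult_right power2_eq_square algebra_simps)
    qed
    moreover have "Re (cinner d (H *v v)) = (norm d)\<^sup>2 + l * Re (cinner d v)"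
    proof -
      have "H *v v = d + complex_of_real l *s v" by (simp add: d_def)
      then show ?thesis by (simp add: cinner_add_right cinner_smult_right cinner_self)
    qed
    ultimately show "2 * t * (norm d)\<^sup>2 \<le> t\<^sup>2 * (?q d - l * (norm d)\<^sup>2)"
      by (simp add: algebra_simps)
  qed simp
  then have "H *v v = complex_of_real l *s v" by (simp add: d_def)
  with vW nv show ?thesis by blast
qed

text \<open>An orthonormal set of eigenvectors of largest cardinality is complete. Otherwise its
  orthogonal complement is nonzero, and it is invariant because \<open>H\<close> is Hermitian, so it
  contains a further unit eigenvector.\<close>

theorem hermitian_spectral:
  fixes H :: "complex ^ 'n::finite ^ 'n"
  assumes H: "hermitian H"
  obtains S and l :: "complex ^ 'n \<Rightarrow> real" where "finite S" "orthonormal id S"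
    "\<And>u. u \<in> S \<Longrightarrow> H *v u = complex_of_real (l u) *s u"
    "\<And>v. v = (\<Sum>u\<in>S. cinner u v *s u)"
proof -
  let ?P = "\<lambda>S. orthonormal id S \<and> (\<forall>u\<in>S. \<exists>l. H *v u = complex_of_real l *s u)"
  have "?P {}" by (simp add: orthonormal_def)
  moreover have "\<forall>S. ?P S \<longrightarrow> card S < Suc DIM(complex ^ 'n)"
    using orthonormal_id_finite less_Suc_eq_le by blast
  ultimately have "\<exists>S. ?P S \<and> (\<forall>S'. ?P S' \<longrightarrow> card S' \<le> card S)"
    by (rule ex_has_greatest_nat)
  then obtain S where P: "?P S" and max: "\<And>S'. ?P S' \<Longrightarrow> card S' \<le> card S"
    by blast
  then have on: "orthonormal id S" and fin: "finite S" using orthonormal_id_finite by auto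
  obtain l where l: "\<And>u. u \<in> S \<Longrightarrow> H *v u = complex_of_real (l u) *s u"
    using P bchoice[of S "\<lambda>u l. H *v u = complex_of_real l *s u"] by blast
  have "v = (\<Sum>u\<in>S. cinner u v *s u)" for v
  proof (rule ccontr)
    assume neq: "v \<noteq> (\<Sum>u\<in>S. cinner u v *s u)"
    define W where "W = {x. \<forall>u\<in>S. cinner u x = 0}"
    have "W = (\<Inter>u\<in>S. {x. cinner u x = 0})" by (auto simp: W_def)
    moreover have "closed {x. cinner u x = 0}" for u :: "complex ^ 'n"
      unfolding cinner_def by (intro closed_Collect_eq continuous_intros)
    ultimately have "closed W" by auto
    moreover have "vec.subspace W"
      by (auto simp: W_def vec.subspace_def cinner_add_right cinner_smult_right)
    moreover have "H *v x \<in> W" if "x \<in> W" for x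
      using that by (auto simp: W_def l cinner_smult_left simp flip: hermitian_cinner[OF H])
    moreover have "v - (\<Sum>u\<in>S. cinner u v *s u) \<in> W"
      using cinner_orthonormal_sum[OF fin on, where c = "\<lambda>u. cinner u v"]
      by (auto simp: W_def cinner_diff_right)
    ultimately obtain x m where x: "x \<in> W" "norm x = 1" "H *v x = complex_of_real m *s x"
      using hermitian_eigenvector_in_subspace[OF H, of W "v - (\<Sum>u\<in>S. cinner u v *s u)"] neq
      by auto
    have perp: "cinner u x = 0" "cinner x u = 0" if "u \<in> S" for u
      using x(1) that cnj_cinner[of u x] by (auto simp: W_def)
    have xx: "cinner x x = 1" using x(2) by (simp add: cinner_self)
    have "x \<notin> S" using perp(1)[of x] xx by auto
    moreover have "?P (insert x S)"
      using P x(3) perp xx by (auto simp: orthonormal_def)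
    ultimately show False using max[of "insert x S"] fin by simp
  qed
  then show ?thesis using that fin on l by blast
qed


section \<open>The trace norm of a singular value decomposition\<close>

text \<open>This makes the definite description in \<open>op_abs\<close> meaningful. It suffices
  that \<open>P\<close> and \<open>Q\<close> agree on an eigenbasis of \<open>Q\<close>.\<close>

lemma psd_sqrt_unique:
  fixes P Q :: "complex ^ 'n::finite ^ 'n"
  assumes P: "psd P" and Q: "psd Q" and eq: "P ** P = Q ** Q"
  shows "P = Q"
proof -
  have "hermitian Q" using Q by (simp add: psd_def)
  then obtain S l where S: "finite S" "orthonormal id S"
    and l: "\<And>u. u \<in> S \<Longrightarrow> Q *v u = complex_of_real (l u) *s u"
    and exp: "\<And>v. v = (\<Sum>u\<in>S. cinner u v *s u)"
    by (rule hermitian_spectral) blast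
  have PQ: "P *v u = Q *v u" if u: "u \<in> S" for u
  proof -
    have "cinner u u = 1" using orthonormalD[OF S(2) u u] by simp
    moreover have "0 \<le> Re (cinner u (Q *v u))" using Q by (simp add: psd_def)
    ultimately have lpos: "l u \<ge> 0" by (simp add: l[OF u] cinner_smult_right)
    define w where "w = P *v u - complex_of_real (l u) *s u"
    have "P *v (P *v u) = Q *v (Q *v u)"
      by (simp add: matrix_vector_mul_assoc eq)
    also have "\<dots> = complex_of_real (l u) *s (complex_of_real (l u) *s u)"
      by (simp add: l[OF u] mult_vec_smult)
    finally have PP: "P *v (P *v u) = complex_of_real (l u) *s (complex_of_real (l u) *s u)" .
    \<comment> \<open>With \<open>w = (P - l) u\<close> this is the factorization
      \<open>(P + l) (P - l) u = (P^2 - l^2) u = 0\<close>. For \<open>l > 0\<close> a nonzero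
      \<open>w\<close> would give \<open>P\<close> a negative expectation value.\<close>
    then have Pw: "P *v w = - complex_of_real (l u) *s w"
      by (simp add: w_def matrix_vector_mult_diff_distrib mult_vec_smult vec_eq_iff algebra_simps)
    have "w = 0"
    proof (cases "l u = 0")
      case True
      have "cinner (P *v u) (P *v u) = cinner u (P *v (P *v u))"
        using P by (simp add: hermitian_cinner psd_def)
      then show ?thesis using True PP by (simp add: w_def)
    next
      case False
      have "0 \<le> Re (cinner w (P *v w))" using P by (simp add: psd_def)
      then have "l u * (norm w)\<^sup>2 \<le> 0"
        unfolding Pw cinner_smult_right cinner_self by simp
      then show ?thesis using False lpos by (simp add: mult_le_0_iff)
    qed
    then show ?thesis by (simp add: w_def l[OF u])
  qed
  have "P *v v = Q *v v" for v
    by (subst (1 2) exp[of v]) (simp add: mult_vec_sum mult_vec_smult PQ)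
  then show ?thesis by (simp add: matrix_eq)
qed

lemma op_abs_eqI: "psd P \<Longrightarrow> P ** P = cadjoint X ** X \<Longrightarrow> op_abs X = P"
  unfolding op_abs_def by (rule the_equality) (auto intro: psd_sqrt_unique)

section \<open>Sums of rank-one operators\<close>

lemma ketbra_mult_vec: "ketbra v w *v x = cinner w x *s v"
  by (simp add: vec_eq_iff ketbra_def cinner_def matrix_vector_mult_def sum_distrib_left mult_ac)

lemma trace_ketbra: "trace (ketbra v w) = cinner w v"
  by (simp add: trace_def ketbra_def cinner_def mult.commute)

lemma trace_ketbra_mult: "trace (ketbra a b ** ketbra c d) = cinner b c * cinner d a"
proof -
  have "ketbra a b ** ketbra c d = ketbra (cinner b c *s a) d"
    by (simp add: matrix_eq ketbra_mult_vec mult_vec_smult flip: matrix_vector_mul_assoc)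
  then show ?thesis by (simp add: trace_ketbra cinner_smult_right)
qed

lemma trace_sum_scaleR:
  "trace (\<Sum>i\<in>I. c i *\<^sub>R (A i :: complex ^ 'n ^ 'n)) = (\<Sum>i\<in>I. complex_of_real (c i) * trace (A i))"
proof -
  have "trace (\<Sum>i\<in>I. c i *\<^sub>R A i) = (\<Sum>j\<in>UNIV. \<Sum>i\<in>I. complex_of_real (c i) * A i $ j $ j)"
    by (simp add: trace_def scaleR_conv_of_real [where 'a = complex])
  also have "\<dots> = (\<Sum>i\<in>I. complex_of_real (c i) * trace (A i))"
    by (subst sum.swap) (simp add: trace_def sum_distrib_left)
  finally show ?thesis .
qed

lemma cadjoint_sum_ketbra:
  "cadjoint (\<Sum>i\<in>I. c i *\<^sub>R ketbra (f i) (e i)) = (\<Sum>i\<in>I. c i *\<^sub>R ketbra (e i) (f i))"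
  by (simp add: vec_eq_iff cadjoint_def ketbra_def mult.commute)

lemma sum_ketbra_mult_vec:
  "(\<Sum>i\<in>I. c i *\<^sub>R ketbra (f i) (e i)) *v x = (\<Sum>i\<in>I. (complex_of_real (c i) * cinner (e i) x) *s f i)"
proof -
  have "(c i *\<^sub>R ketbra (f i) (e i)) *v x = (complex_of_real (c i) * cinner (e i) x) *s f i" for i
  proof -
    have "(c i *\<^sub>R ketbra (f i) (e i)) *v x = c i *\<^sub>R (ketbra (f i) (e i) *v x)"
      by (simp add: vec_eq_iff matrix_vector_mult_def scaleR_sum_right)
    then show ?thesis
      by (simp add: ketbra_mult_vec vec_eq_iff scaleR_conv_of_real [where 'a = complex])
  qed
  then show ?thesis by (simp add: sum_mult_vec)
qed

text \<open>The sum is a singular value decomposition. Orthonormality of \<open>f\<close> removes it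
  from \<open>cadjoint X ** X\<close>, so the absolute value is the same sum with \<open>e i\<close>
  in place of \<open>f i\<close>, which is the \<open>P\<close> of the proof.\<close>

lemma trace_norm_orthonormal_sum:
  fixes e f :: "'i \<Rightarrow> complex ^ 'n::finite"
  assumes I: "finite I" and e: "orthonormal e I" and f: "orthonormal f I"
    and c: "\<And>i. i \<in> I \<Longrightarrow> c i \<ge> 0"
  shows "trace_norm (\<Sum>i\<in>I. c i *\<^sub>R ketbra (f i) (e i)) = (\<Sum>i\<in>I. c i)"
proof -
  define X where "X = (\<Sum>i\<in>I. c i *\<^sub>R ketbra (f i) (e i))"
  define P where "P = (\<Sum>i\<in>I. c i *\<^sub>R ketbra (e i) (e i))"
  have Pv: "P *v v = (\<Sum>i\<in>I. (complex_of_real (c i) * cinner (e i) v) *s e i)" for v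
    unfolding P_def by (rule sum_ketbra_mult_vec)
  have Xv: "X *v v = (\<Sum>i\<in>I. (complex_of_real (c i) * cinner (e i) v) *s f i)" for v
    unfolding X_def by (rule sum_ketbra_mult_vec)
  have "hermitian P" by (simp add: hermitian_def P_def cadjoint_sum_ketbra)
  moreover have "0 \<le> Re (cinner v (P *v v))" for v
  proof -
    have "cinner v (P *v v) = (\<Sum>i\<in>I. complex_of_real (c i * (cmod (cinner (e i) v))\<^sup>2))"
      unfolding Pv cinner_sum_right cinner_smult_right
    proof (rule sum.cong[OF refl])
      fix i
      show "complex_of_real (c i) * cinner (e i) v * cinner v (e i) =
            complex_of_real (c i * (cmod (cinner (e i) v))\<^sup>2)"
        using complex_norm_square[of "cinner (e i) v"] by (simp add: cnj_cinner mult.assoc)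
    qed
    then show ?thesis by (auto intro!: sum_nonneg mult_nonneg_nonneg c)
  qed
  ultimately have "psd P" by (simp add: psd_def)
  moreover have "P ** P = cadjoint X ** X"
  proof -
    have "cadjoint X *v (X *v v) = P *v (P *v v)" for v
    proof -
      have "cadjoint X *v (X *v v) = (\<Sum>i\<in>I. (complex_of_real (c i) * cinner (f i) (X *v v)) *s e i)"
        unfolding X_def cadjoint_sum_ketbra by (rule sum_ketbra_mult_vec)
      \<comment> \<open>\<open>X v\<close> has along the \<open>f i\<close> the same coefficients as
        \<open>P v\<close> along the \<open>e i\<close>.\<close>
      also have "\<dots> = (\<Sum>i\<in>I. (complex_of_real (c i) * cinner (e i) (P *v v)) *s e i)"
        by (rule sum.cong) (simp_all add: Xv Pv cinner_orthonormal_sum[OF I e] cinner_orthonormal_sum[OF I f])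
      also have "\<dots> = P *v (P *v v)" by (rule Pv[symmetric])
      finally show ?thesis .
    qed
    then show ?thesis by (simp add: matrix_eq flip: matrix_vector_mul_assoc)
  qed
  ultimately have "op_abs X = P" by (rule op_abs_eqI)
  then have "trace_norm X = Re (\<Sum>i\<in>I. complex_of_real (c i) * cinner (e i) (e i))"
    by (simp add: trace_norm_def P_def trace_sum_scaleR trace_ketbra)
  also have "\<dots> = (\<Sum>i\<in>I. c i)" using e by (simp add: orthonormalD)
  finally show ?thesis by (simp add: X_def)
qed

section \<open>Positivity of the ground state\<close>

text \<open>Variational principle. In an eigenbasis the excess energy is the sum of
  \<open>(l u - E) |<u, v>|^2\<close>; all terms are nonnegative and the sum is at most 0, so
  \<open>v\<close> has components only at eigenvalue \<open>E\<close>.\<close>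

lemma eigenspace_minI:
  fixes G :: "complex ^ 'n::finite ^ 'n"
  assumes G: "hermitian G" and min: "\<And>m :: real. eigenvalue G (complex_of_real m) \<Longrightarrow> E \<le> m"
    and le: "Re (cinner v (G *v v)) \<le> E * (norm v)\<^sup>2"
  shows "v \<in> eigenspace G (complex_of_real E)"
proof -
  obtain S l where S: "finite S" "orthonormal id S"
    and l: "\<And>u. u \<in> S \<Longrightarrow> G *v u = complex_of_real (l u) *s u"
    and exp: "\<And>v. v = (\<Sum>u\<in>S. cinner u v *s u)"
    by (rule hermitian_spectral[OF G]) blast
  have Gv: "G *v v = (\<Sum>u\<in>S. (complex_of_real (l u) * cinner u v) *s u)"
    by (subst exp[of v]) (simp add: mult_vec_sum mult_vec_smult l vector_smult_assoc mult.commute)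
  have form: "cinner v (\<Sum>u\<in>S. (complex_of_real (a u) * cinner u v) *s u) =
      complex_of_real (\<Sum>u\<in>S. a u * (cmod (cinner u v))\<^sup>2)" for a
    unfolding cinner_sum_right cinner_smult_right of_real_sum
  proof (rule sum.cong[OF refl])
    fix u
    show "complex_of_real (a u) * cinner u v * cinner v u =
          complex_of_real (a u * (cmod (cinner u v))\<^sup>2)"
      using complex_norm_square[of "cinner u v"] by (simp add: cnj_cinner mult.assoc)
  qed
  have "(norm v)\<^sup>2 = (\<Sum>u\<in>S. 1 * (cmod (cinner u v))\<^sup>2)"
    using form[of "\<lambda>_. 1"] exp[of v] by (simp add: cinner_self del: of_real_sum of_real_power)
  then have sum: "(\<Sum>u\<in>S. (l u - E) * (cmod (cinner u v))\<^sup>2) \<le> 0"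
    using le form[of l] by (simp add: Gv left_diff_distrib sum_subtractf sum_distrib_left del: of_real_sum)
  have ge: "E \<le> l u" if "u \<in> S" for u
  proof (rule min)
    have "u \<noteq> 0" using orthonormalD[OF S(2) that that] by auto
    then show "eigenvalue G (complex_of_real (l u))"
      using l[OF that] by (auto simp: eigenvalue_def eigenspace_def)
  qed
  have nonneg: "\<And>u. u \<in> S \<Longrightarrow> 0 \<le> (l u - E) * (cmod (cinner u v))\<^sup>2"
    using ge by simp
  then have "(\<Sum>u\<in>S. (l u - E) * (cmod (cinner u v))\<^sup>2) = 0"
    using sum by (intro antisym sum_nonneg)
  then have zero: "l u = E \<or> cinner u v = 0" if "u \<in> S" for u
    using nonneg S(1) that by (simp add: sum_nonneg_eq_0_iff)
  have "G *v v = (\<Sum>u\<in>S. complex_of_real E *s (cinner u v *s u))"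
    unfolding Gv by (rule sum.cong) (use zero in \<open>auto simp: vector_smult_assoc\<close>)
  also have "\<dots> = complex_of_real E *s (\<Sum>u\<in>S. cinner u v *s u)"
    by (simp add: vec.scale_sum_right)
  finally show ?thesis by (simp add: eigenspace_def flip: exp[of v])
qed

section \<open>Tensor products and entrywise conjugation\<close>

lemma sum_UNIV_prod:
  fixes f :: "('a::finite \<times> 'b::finite) \<Rightarrow> 'c::comm_monoid_add"
  shows "(\<Sum>p\<in>UNIV. f p) = (\<Sum>i\<in>UNIV. \<Sum>j\<in>UNIV. f (i, j))"
  by (simp add: sum.cartesian_product)

lemma cinner_tensor_vec:
  "cinner (tensor_vec a b) (tensor_vec c d) = cinner a c * cinner b d"
  by (simp add: cinner_def tensor_vec_def sum_UNIV_prod sum_product mult_ac)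

lemma tensor_op_mult_vec: "tensor_op A B *v tensor_vec a b = tensor_vec (A *v a) (B *v b)"
  by (simp add: vec_eq_iff tensor_op_def tensor_vec_def matrix_vector_mult_def sum_UNIV_prod
      sum_product mult_ac)

definition vcnj :: "complex ^ 'n \<Rightarrow> complex ^ 'n" where
  "vcnj v = (\<chi> i. cnj (v $ i))"

lemma cinner_vcnj: "cinner (vcnj a) (vcnj b) = cnj (cinner a b)"
  by (simp add: cinner_def vcnj_def)

lemma real_matrix_mult_vcnj:
  assumes "real_matrix B"
  shows "B *v vcnj x = vcnj (B *v x)"
proof -
  have "cnj (B $ i $ j) = B $ i $ j" for i j
    using assms by (simp add: real_matrix_def Reals_cnj_iff)
  then show ?thesis by (simp add: vec_eq_iff vcnj_def matrix_vector_mult_def)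
qed

text \<open>As a matrix, \<open>herm_square u\<close> is the rank one operator \<open>u u\<^sup>*\<close>.\<close>

definition herm_square :: "complex ^ 'n::finite \<Rightarrow> complex ^ ('n \<times> 'n)" where
  "herm_square u = tensor_vec u (vcnj u)"

lemma cinner_herm_square: "cinner (herm_square u) (herm_square w) = cinner u w * cnj (cinner u w)"
  by (simp add: herm_square_def cinner_tensor_vec cinner_vcnj)

text \<open>A real \<open>B\<close> commutes with entrywise conjugation, so the second factor is the
  conjugate of \<open><u, B w>\<close>. For \<open>A = B\<close> the product is a squared
  modulus.\<close>

lemma cinner_herm_square_tensor_op:
  "real_matrix B \<Longrightarrow> cinner (herm_square u) (tensor_op A B *v herm_square w) =
     cinner u (A *v w) * cnj (cinner u (B *v w))"
  by (simp add: herm_square_def tensor_op_mult_vec cinner_tensor_vec real_matrix_mult_vcnj cinner_vcnj)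

lemma real_matrix_mat_1: "real_matrix (mat 1)"
  by (simp add: real_matrix_def mat_def)

text \<open>The two local terms carry a factor \<open><u, w> = 0\<close> or its conjugate. What
  remains is the sum of \<open>b k |<u, B k w>|^2\<close>, with \<open>b k \<le> 0\<close>.\<close>

lemma swap_invariant_off_diagonal_le:
  assumes "negative_swap_invariant G" "cinner u w = 0"
  shows "Re (cinner (herm_square u) (G *v herm_square w)) \<le> 0"
proof -
  obtain A m b B where A: "real_matrix A" and B: "\<And>k. k < m \<Longrightarrow> b k \<le> (0::real) \<and> real_matrix (B k)"
    and G: "G = tensor_op (mat 1) A + tensor_op A (mat 1)
            + (\<Sum>k<(m::nat). b k *\<^sub>R tensor_op (B k) (B k))"
    using assms(1) unfolding negative_swap_invariant_def by blast
  have sc: "(r *\<^sub>R M) *v x = complex_of_real r *s (M *v x)" for r and M :: "complex ^ ('a \<times> 'a) ^ ('a \<times> 'a)" and x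
    by (simp add: vec_eq_iff matrix_vector_mult_def sum_distrib_left scaleR_conv_of_real [where 'a = complex] mult.assoc)
  have "cinner (herm_square u) (G *v herm_square w) =
      (\<Sum>k<m. complex_of_real (b k) * (cinner u (B k *v w) * cnj (cinner u (B k *v w))))"
    using A B assms(2)
    by (simp add: G matrix_vector_mult_add_rdistrib cinner_add_right cinner_herm_square_tensor_op
       real_matrix_mat_1 sum_mult_vec cinner_sum_right sc cinner_smult_right)
  also have "\<dots> = complex_of_real (\<Sum>k<m. b k * (cmod (cinner u (B k *v w)))\<^sup>2)"
    by (simp only: of_real_sum of_real_mult complex_norm_square)
  finally show ?thesis using B by (auto intro!: sum_nonpos mult_nonpos_nonneg)
qed

text \<open>Conjugation fixes the entries of \<open>A\<close> and \<open>B k\<close>; exchanging the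
  tensor factors interchanges the two local terms and fixes each
  \<open>tensor_op (B k) (B k)\<close>.\<close>

lemma negative_swap_invariant_entries:
  assumes "negative_swap_invariant G"
  shows "cnj (G $ (i, j) $ (k, l)) = G $ (j, i) $ (l, k)"
proof -
  obtain A m b B where A: "real_matrix A" and B: "\<And>k. k < m \<Longrightarrow> b k \<le> (0::real) \<and> real_matrix (B k)"
    and G: "G = tensor_op (mat 1) A + tensor_op A (mat 1)
            + (\<Sum>k<(m::nat). b k *\<^sub>R tensor_op (B k) (B k))"
    using assms(1) unfolding negative_swap_invariant_def by blast
  have cA: "cnj (A $ i $ j) = A $ i $ j" for i j
    using A by (simp add: real_matrix_def Reals_cnj_iff)
  have cB: "cnj (B q $ i $ j) = B q $ i $ j" if "q < m" for i j q
    using B[OF that] by (simp add: real_matrix_def Reals_cnj_iff)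
  show ?thesis
    by (simp add: G tensor_op_def cA cB mat_def mult.commute)
qed

text \<open>On vectors read as matrices, \<open>swap_cnj\<close> is the adjoint.\<close>

definition swap_cnj :: "complex ^ ('n::finite \<times> 'n) \<Rightarrow> complex ^ ('n \<times> 'n)" where
  "swap_cnj x = (\<chi> p. cnj (x $ prod.swap p))"

text \<open>Consequently eigenspaces of \<open>G\<close> for real eigenvalues are stable under
  \<open>swap_cnj\<close>.\<close>

lemma swap_cnj_mult_vec:
  fixes G :: "complex ^ ('n::finite \<times> 'n) ^ ('n \<times> 'n)"
  assumes "negative_swap_invariant G"
  shows "G *v swap_cnj x = swap_cnj (G *v x)"
proof -
  have "(G *v swap_cnj x) $ (i, j) = swap_cnj (G *v x) $ (i, j)" for i j
  proof -
    have "swap_cnj (G *v x) $ (i, j) = (\<Sum>k\<in>UNIV. \<Sum>l\<in>UNIV. G $ (i, j) $ (l, k) * cnj (x $ (k, l)))"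
      by (simp add: swap_cnj_def matrix_vector_mult_def sum_UNIV_prod negative_swap_invariant_entries[OF assms])
    also have "\<dots> = (\<Sum>l\<in>UNIV. \<Sum>k\<in>UNIV. G $ (i, j) $ (l, k) * cnj (x $ (k, l)))"
      by (rule sum.swap)
    also have "\<dots> = (G *v swap_cnj x) $ (i, j)"
      by (simp add: swap_cnj_def matrix_vector_mult_def sum_UNIV_prod)
    finally show ?thesis by simp
  qed
  then show ?thesis by (simp add: vec_eq_iff)
qed

section \<open>Spectral form of vectors that are Hermitian as matrices\<close>

lemma cinner_axis_right: "cinner u (axis j 1) = cnj (u $ j)"
  by (simp add: cinner_def axis_def if_distrib cong: if_cong)

lemma cinner_axis_left: "cinner (axis j 1) u = u $ j"
  using cnj_cinner[of u "axis j 1"] by (simp add: cinner_axis_right)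

text \<open>A fixed point of \<open>swap_cnj\<close> is a Hermitian matrix, and the expansion is its
  spectral decomposition, obtained column by column by expanding \<open>axis j 1\<close> in the
  eigenbasis.\<close>

lemma herm_square_expansion:
  fixes h :: "complex ^ ('n::finite \<times> 'n)"
  assumes "swap_cnj h = h"
  obtains S and l :: "complex ^ 'n \<Rightarrow> real" where "finite S" "orthonormal id S"
    "h = (\<Sum>u\<in>S. complex_of_real (l u) *s herm_square u)"
proof -
  define H where "H = (\<chi> i j. h $ (i, j))"
  have "cnj (h $ (j, i)) = h $ (i, j)" for i j
    using arg_cong[OF assms, of "\<lambda>x. x $ (i, j)"] by (simp add: swap_cnj_def)
  then have "hermitian H"
    by (simp add: hermitian_def cadjoint_def H_def vec_eq_iff)
  then obtain S l where S: "finite S" "orthonormal id S"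
    and l: "\<And>u. u \<in> S \<Longrightarrow> H *v u = complex_of_real (l u) *s u"
    and exp: "\<And>v. v = (\<Sum>u\<in>S. cinner u v *s u)"
    by (rule hermitian_spectral) blast
  have "h $ (i, j) = (\<Sum>u\<in>S. complex_of_real (l u) *s herm_square u) $ (i, j)" for i j
  proof -
    have "h $ (i, j) = (H *v axis j 1) $ i"
      by (simp add: matrix_vector_mult_def axis_def H_def if_distrib cong: if_cong)
    also have "H *v axis j 1 = (\<Sum>u\<in>S. cinner u (axis j 1) *s (complex_of_real (l u) *s u))"
      by (subst exp[of "axis j 1"]) (simp add: mult_vec_sum mult_vec_smult l)
    finally show ?thesis by (simp add: cinner_axis_right herm_square_def tensor_vec_def vcnj_def mult_ac)
  qed
  then have "h = (\<Sum>u\<in>S. complex_of_real (l u) *s herm_square u)" by (simp add: vec_eq_iff)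
  with S show ?thesis by (rule that)
qed

lemma orthonormal_herm_square: "orthonormal id S \<Longrightarrow> orthonormal herm_square S"
  by (auto simp: orthonormal_def cinner_herm_square)

text \<open>Only the squares of the \<open>l u\<close> enter, so replacing \<open>l\<close> by its
  absolute value preserves the norm.\<close>

lemma norm_herm_square_sum:
  assumes "finite S" "orthonormal id S"
  shows "(norm (\<Sum>u\<in>S. complex_of_real (l u) *s herm_square u))\<^sup>2 = (\<Sum>u\<in>S. (l u)\<^sup>2)"
proof -
  let ?x = "\<Sum>u\<in>S. complex_of_real (l u) *s herm_square u"
  have "cinner ?x ?x = (\<Sum>u\<in>S. complex_of_real (l u) * cinner (herm_square u) ?x)"
    by (subst (1) cinner_sum_left) (simp add: cinner_smult_left)
  also have "\<dots> = complex_of_real (\<Sum>u\<in>S. (l u)\<^sup>2)"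
    using cinner_orthonormal_sum[OF assms(1) orthonormal_herm_square[OF assms(2)]]
    by (simp add: power2_eq_square)
  finally show ?thesis by (simp add: cinner_self del: of_real_sum of_real_power)
qed

text \<open>Diagonal terms contain \<open>(l u)\<^sup>2\<close> and stay the same. Off the diagonal
  the coefficient is nonpositive, and \<open>l u * l w\<close> can only grow when absolute values
  are taken.\<close>

lemma energy_herm_square_abs_le:
  assumes G: "negative_swap_invariant G" and S: "orthonormal id S"
  defines "x \<equiv> \<lambda>l :: _ \<Rightarrow> real. \<Sum>u\<in>S. complex_of_real (l u) *s herm_square u"
  shows "Re (cinner (x (\<lambda>u. \<bar>l u\<bar>)) (G *v x (\<lambda>u. \<bar>l u\<bar>))) \<le> Re (cinner (x l) (G *v x l))"
proof -
  let ?g = "\<lambda>u w. Re (cinner (herm_square u) (G *v herm_square w))"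
  have energy: "Re (cinner (x l) (G *v x l)) = (\<Sum>u\<in>S. \<Sum>w\<in>S. l u * l w * ?g u w)" for l
    unfolding x_def cinner_sum_left cinner_smult_left
    by (simp add: mult_vec_sum mult_vec_smult cinner_sum_right cinner_smult_right
        sum_distrib_left mult.assoc)
  have "\<bar>l u\<bar> * \<bar>l w\<bar> * ?g u w \<le> l u * l w * ?g u w" if "u \<in> S" "w \<in> S" for u w
  proof (cases "u = w")
    case False
    then have "?g u w \<le> 0"
      using swap_invariant_off_diagonal_le[OF G] S that by (simp add: orthonormal_def)
    then show ?thesis by (intro mult_right_mono_neg) (simp_all flip: abs_mult)
  qed simp
  then show ?thesis unfolding energy by (intro sum_mono)
qed

lemma eigenspace_dim_1:
  assumes "vec.dim (eigenspace G \<mu>) = 1" "x \<in> eigenspace G \<mu>" "y \<in> eigenspace G \<mu>" "y \<noteq> 0"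
  obtains c where "x = c *s y"
proof -
  obtain B where B: "eigenspace G \<mu> \<subseteq> vec.span B" "card B = 1"
    using vec.basis_exists[of "eigenspace G \<mu>"] assms(1) by metis
  then obtain b where "eigenspace G \<mu> \<subseteq> range (\<lambda>k. k *s b)"
    by (metis card_1_singletonE vec.span_singleton)
  then obtain s t where "x = s *s b" "y = t *s b" using assms(2,3) by blast
  moreover from this assms(4) have "t \<noteq> 0" by auto
  ultimately have "x = (s / t) *s y" by (simp add: vector_smult_assoc)
  then show ?thesis by (rule that)
qed

text \<open>Read as a matrix, the ground state is a scalar multiple of a positive semidefinite
  matrix. The factor \<open>z\<close> absorbs both the free phase and the normalization.\<close>

theorem ground_state_positive:
  fixes G :: "complex ^ ('n::finite \<times> 'n) ^ ('n \<times> 'n)"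
  assumes G: "negative_swap_invariant G" and \<psi>: "nondegenerate_ground_state G \<psi>"
  obtains S z and a :: "complex ^ 'n \<Rightarrow> real" where "finite S" "orthonormal id S"
    "\<And>u. a u \<ge> 0" "\<psi> = z *s (\<Sum>u\<in>S. complex_of_real (a u) *s herm_square u)"
proof -
  obtain E where E: "\<psi> \<in> eigenspace G (complex_of_real E)" (is "_ \<in> ?V")
    and min: "\<And>m :: real. eigenvalue G (complex_of_real m) \<Longrightarrow> E \<le> m"
    and dim: "vec.dim (eigenspace G (complex_of_real E)) = 1" and n: "norm \<psi> = 1"
    using \<psi> unfolding nondegenerate_ground_state_def by blast
  \<comment> \<open>The Hermitian part of the ground state, unless it is anti-Hermitian; then \<open>\<i> \<psi>\<close> is Hermitian.\<close>
  have "\<exists>h\<in>?V. h \<noteq> 0 \<and> swap_cnj h = h"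
  proof (cases "\<psi> + swap_cnj \<psi> = 0")
    case False
    have "swap_cnj \<psi> \<in> ?V"
      using E by (simp add: eigenspace_def swap_cnj_mult_vec[OF G]) (simp add: swap_cnj_def vec_eq_iff)
    then have "\<psi> + swap_cnj \<psi> \<in> ?V"
      using E by (simp add: eigenspace_def matrix_vector_right_distrib vector_add_ldistrib)
    moreover have "swap_cnj (\<psi> + swap_cnj \<psi>) = \<psi> + swap_cnj \<psi>"
      by (simp add: swap_cnj_def vec_eq_iff)
    ultimately show ?thesis using False by blast
  next
    case True
    have "\<i> *s \<psi> \<in> ?V"
      using E by (simp add: eigenspace_def mult_vec_smult vector_smult_assoc mult.commute)
    moreover have "\<i> *s \<psi> \<noteq> 0" using n by auto
    moreover have "cnj (\<psi> $ prod.swap p) = - \<psi> $ p" for p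
      using arg_cong[OF True, of "\<lambda>x. x $ p"] by (simp add: swap_cnj_def eq_neg_iff_add_eq_0 add.commute)
    then have "swap_cnj (\<i> *s \<psi>) = \<i> *s \<psi>"
      by (simp add: swap_cnj_def vec_eq_iff del: split_paired_All swap_simp)
    ultimately show ?thesis by blast
  qed
  then obtain h where h: "h \<in> ?V" "h \<noteq> 0" "swap_cnj h = h" by blast
  obtain S l where S: "finite S" "orthonormal id S"
    and hl: "h = (\<Sum>u\<in>S. complex_of_real (l u) *s herm_square u)"
    using herm_square_expansion[OF h(3)] by blast
  define p where "p = (\<Sum>u\<in>S. complex_of_real \<bar>l u\<bar> *s herm_square u)"
  \<comment> \<open>Equal norms turn the energy \<open>E |h|^2\<close> of \<open>h\<close> into the
    bound \<open>E |p|^2\<close> that \<open>eigenspace_minI\<close> asks for.\<close>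
  have np: "(norm p)\<^sup>2 = (norm h)\<^sup>2"
    unfolding p_def hl norm_herm_square_sum[OF S] by simp
  have "Re (cinner p (G *v p)) \<le> Re (cinner h (G *v h))"
    unfolding p_def hl by (rule energy_herm_square_abs_le[OF G S(2)])
  also have "\<dots> = E * (norm p)\<^sup>2"
    using h(1) by (simp add: eigenspace_def cinner_smult_right cinner_self np)
  finally have "p \<in> ?V"
    using G by (intro eigenspace_minI min) (simp_all add: negative_swap_invariant_def)
  moreover have "p \<noteq> 0" using np h(2) by auto
  ultimately obtain z where "\<psi> = z *s p" using eigenspace_dim_1[OF dim E] by blast
  then show ?thesis using that[of S "\<lambda>u. \<bar>l u\<bar>" z] S by (simp add: p_def)
qed

section \<open>The partial transpose of the ground state\<close>

text \<open>These are the right and the left singular vectors of the partial transpose of the ground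
  state projector.\<close>

lemma orthonormal_tensor_vcnj:
  assumes "orthonormal id S"
  shows "orthonormal (\<lambda>(u, w). tensor_vec (vcnj u) (vcnj w)) (S \<times> S)"
    and "orthonormal (\<lambda>(u, w). tensor_vec (vcnj w) (vcnj u)) (S \<times> S)"
  using assms by (auto simp: orthonormal_def cinner_tensor_vec cinner_vcnj)

lemma mult_sum_product:
  fixes c :: "'a :: comm_semiring_0"
  shows "c * ((\<Sum>i\<in>I. f i) * (\<Sum>j\<in>J. g j)) = (\<Sum>i\<in>I. \<Sum>j\<in>J. c * (f i * g j))"
  by (simp only: sum_product) (simp add: sum_distrib_left)

text \<open>In the term for \<open>u\<close>, \<open>w\<close>, the first tensor factor is
  \<open>ketbra u w\<close>, with transpose \<open>ketbra (vcnj w) (vcnj u)\<close>; the second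
  factor \<open>ketbra (vcnj u) (vcnj w)\<close> stays. Regrouping gives one rank-one
  operator.\<close>

lemma partial_transpose_herm_square_sum:
  assumes "\<psi> = z *s (\<Sum>u\<in>S. complex_of_real (a u) *s herm_square u)"
  shows "partial_transpose (ketbra \<psi> \<psi>) =
    (\<Sum>p\<in>S \<times> S. ((cmod z)\<^sup>2 * a (fst p) * a (snd p)) *\<^sub>R
       ketbra ((\<lambda>(u, w). tensor_vec (vcnj w) (vcnj u)) p) ((\<lambda>(u, w). tensor_vec (vcnj u) (vcnj w)) p))"
proof -
  have "partial_transpose (ketbra \<psi> \<psi>) $ (i, j) $ (k, l) =
    (\<Sum>u\<in>S. \<Sum>w\<in>S. complex_of_real ((cmod z)\<^sup>2 * a u * a w) * (cnj (w $ i) * cnj (u $ j) * (u $ k * w $ l)))"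
    for i j k l
  proof -
    have "partial_transpose (ketbra \<psi> \<psi>) $ (i, j) $ (k, l) = z * cnj z *
       ((\<Sum>u\<in>S. complex_of_real (a u) * (u $ k * cnj (u $ j))) *
        (\<Sum>w\<in>S. complex_of_real (a w) * (cnj (w $ i) * w $ l)))"
      by (simp add: partial_transpose_def ketbra_def assms herm_square_def tensor_vec_def vcnj_def)
    also have "\<dots> = complex_of_real ((cmod z)\<^sup>2) *
       ((\<Sum>u\<in>S. complex_of_real (a u) * (u $ k * cnj (u $ j))) *
        (\<Sum>w\<in>S. complex_of_real (a w) * (cnj (w $ i) * w $ l)))"
      by (simp only: complex_norm_square)
    finally show ?thesis
      unfolding mult_sum_product by (simp add: mult_ac)
  qed
  then show ?thesis
    by (simp add: vec_eq_iff sum.cartesian_product)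
      (simp add: ketbra_def tensor_vec_def vcnj_def split_beta scaleR_conv_of_real [where 'a = complex])
qed

text \<open>As a matrix \<open>Phi\<close> is the identity, so the overlap with it is a
  trace.\<close>

lemma cinner_Phi_herm_square: "cinner Phi (herm_square u) = cinner u u"
proof -
  have "cinner Phi (herm_square u) = (\<Sum>i\<in>UNIV. cinner (axis i 1) u * cinner (axis i 1) (vcnj u))"
    by (simp add: Phi_def herm_square_def cinner_sum_left cinner_tensor_vec)
  then show ?thesis by (simp add: cinner_axis_left cinner_def[of u] vcnj_def mult.commute)
qed

theorem theorem1:
  fixes G :: "complex ^ ('n::finite \<times> 'n) ^ ('n \<times> 'n)"
    and \<psi> :: "complex ^ ('n \<times> 'n)"
    and b :: real
  assumes "negative_swap_invariant G"
    and "nondegenerate_ground_state G \<psi>"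
    and "0 < b" and "b \<noteq> 1"
  shows "0 < Re (trace (ketbra Phi Phi ** ketbra \<psi> \<psi>)) \<and>
         log_negativity b (ketbra \<psi> \<psi>) = log b (Re (trace (ketbra Phi Phi ** ketbra \<psi> \<psi>)))"
proof -
  obtain S z and a :: "complex ^ 'n \<Rightarrow> real" where S: "finite S" "orthonormal id S"
    and a: "\<And>u. a u \<ge> 0" and \<psi>: "\<psi> = z *s (\<Sum>u\<in>S. complex_of_real (a u) *s herm_square u)"
    using ground_state_positive[OF assms(1,2)] by blast
  have "trace_norm (partial_transpose (ketbra \<psi> \<psi>)) = (\<Sum>p\<in>S \<times> S. (cmod z)\<^sup>2 * a (fst p) * a (snd p))"
    unfolding partial_transpose_herm_square_sum[OF \<psi>]
    using S a by (intro trace_norm_orthonormal_sum orthonormal_tensor_vcnj) auto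
  \<comment> \<open>The sum over pairs factors into two equal sums.\<close>
  also have "\<dots> = (cmod z * (\<Sum>u\<in>S. a u))\<^sup>2"
    unfolding power_mult_distrib power2_eq_square[of "sum a S"] mult_sum_product sum.cartesian_product
    by (simp add: split_beta mult.assoc)
  finally have norm: "trace_norm (partial_transpose (ketbra \<psi> \<psi>)) = (cmod z * (\<Sum>u\<in>S. a u))\<^sup>2" .
  have "cinner Phi \<psi> = z * complex_of_real (\<Sum>u\<in>S. a u)"
    using S(2) by (simp add: \<psi> cinner_smult_right cinner_sum_right cinner_Phi_herm_square orthonormal_def)
  moreover have "trace (ketbra Phi Phi ** ketbra \<psi> \<psi>) = complex_of_real ((cmod (cinner Phi \<psi>))\<^sup>2)"
    unfolding trace_ketbra_mult complex_norm_square cnj_cinner ..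
  ultimately have tr: "Re (trace (ketbra Phi Phi ** ketbra \<psi> \<psi>)) = (cmod z * (\<Sum>u\<in>S. a u))\<^sup>2"
    using a by (simp add: norm_mult sum_nonneg del: of_real_sum)
  \<comment> \<open>A nonzero ground state needs \<open>z \<noteq> 0\<close> and some
    \<open>a u \<noteq> 0\<close>; as all \<open>a u\<close> are nonnegative, their sum cannot
    vanish. This makes the argument of the logarithm positive.\<close>
  have "\<psi> \<noteq> 0" using assms(2) by (auto simp: nondegenerate_ground_state_def)
  then have "z \<noteq> 0" by (auto simp: \<psi>)
  have "\<exists>u\<in>S. a u \<noteq> 0"
    using \<open>\<psi> \<noteq> 0\<close> unfolding \<psi> by (rule contrapos_np) simp
  then have "(\<Sum>u\<in>S. a u) \<noteq> 0"
    using S(1) a by (simp add: sum_nonneg_eq_0_iff)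
  with \<open>z \<noteq> 0\<close> show ?thesis by (simp add: log_negativity_def tr norm)
qed

end
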